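(* Let $d\ge1$ and let $\Lambda \subset \mathbb R^{2d}$ be a lattice. Then $\Lambda$ is symplectically related to a separable lattice if and only if there exists $K \in \mathrm{GL}(d,\mathbb R)$ such that $\begin{pmatrix} 0 & K \\ - K^T & 0 \end{pmatrix} \in \Theta_\Lambda$. In other words, the following conditions are equivalent. (a) There exists $A \in \mathrm{GL}(2d,\mathbb R)$ such that $\Lambda = A\mathbb Z^{2d}$ and $A^T J A = \begin{pmatrix} 0 & K \\ - K^T & 0 \end{pmatrix}$ for some $K \in \mathrm{GL}(d,\mathbb R)$. (b) There exist $B \in \mathrm{GL}(2d,\mathbb R)$ of the form $B = \begin{pmatrix} B_1 & 0 \\ 0 & B_2 \end{pmatrix}$ with $B_1, B_2 \in \mathrm{GL}(d,\mathbb R)$, and $S \in \mathrm{Sp}(2d,\mathbb R)$, such that $\Lambda = SB \mathbb Z^{2d}$.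
   Context: $J = \begin{pmatrix} 0 & I \\ -I & 0\end{pmatrix}$ is the standard $2d\times 2d$ symplectic matrix; $\mathrm{Sp}(2d,\mathbb R)=\{S : S^TJS=J\}$. A lattice in $\mathbb R^{2d}$ is a set $A\mathbb Z^{2d}$ with $A\in\mathrm{GL}(2d,\mathbb R)$. A lattice is separable if it is of the form $\begin{pmatrix} A_1 & 0\\ 0& A_2\end{pmatrix}\mathbb Z^{2d}$ with $A_1,A_2\in\mathrm{GL}(d,\mathbb R)$. Two lattices $\Lambda,\Lambda'$ in $\mathbb R^{2d}$ are symplectically related if $\Lambda'=S\Lambda$ for some $S\in\mathrm{Sp}(2d,\mathbb R)$. For a lattice $\Lambda=A\mathbb Z^{2d}$, $\Theta_\Lambda=\{(AM)^TJ(AM) : M\in\mathrm{GL}(2d,\mathbb Z)\}$, where $\mathrm{GL}(2d,\mathbb Z)$ is the group of integer matrices with integer inverse. *)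

theory Defs
  imports "HOL-Analysis.Analysis"
begin

text \<open>The space of dimension \<open>2d\<close> is \<open>real ^ ('n + 'n)\<close> with \<open>d = CARD('n)\<close>; the tags \<open>Inl\<close> and
  \<open>Inr\<close> select the first and the last \<open>d\<close> coordinates. Since types are nonempty, \<open>d \<ge> 1\<close>.
  The groups \<open>GL\<close> over the reals are given by \<open>invertible\<close>.\<close>

definition block ::
  "real ^ 'n ^ 'n \<Rightarrow> real ^ 'n ^ 'n \<Rightarrow> real ^ 'n ^ 'n \<Rightarrow> real ^ 'n ^ 'n \<Rightarrow>
   real ^ ('n::finite + 'n) ^ ('n + 'n)" where
  "block P Q R T = (\<chi> i j. case i of
      Inl a \<Rightarrow> (case j of Inl b \<Rightarrow> P $ a $ b | Inr b \<Rightarrow> Q $ a $ b)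
    | Inr a \<Rightarrow> (case j of Inl b \<Rightarrow> R $ a $ b | Inr b \<Rightarrow> T $ a $ b))"

definition Jmat :: "real ^ ('n::finite + 'n) ^ ('n + 'n)" where
  "Jmat = block 0 (mat 1) (- mat 1) 0"

definition Sp :: "(real ^ ('n::finite + 'n) ^ ('n + 'n)) set" where
  "Sp = {S. transpose S ** Jmat ** S = Jmat}"

definition int_vecs :: "(real ^ 'm::finite) set" where
  "int_vecs = {v. \<forall>i. v $ i \<in> \<int>}"

definition lattice_of :: "real ^ 'm ^ 'm \<Rightarrow> (real ^ 'm::finite) set" where
  "lattice_of A = (*v) A ` int_vecs"

definition is_lattice :: "(real ^ 'm::finite) set \<Rightarrow> bool" where
  "is_lattice L \<longleftrightarrow> (\<exists>A. invertible A \<and> L = lattice_of A)"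

definition separable_lattice :: "(real ^ ('n::finite + 'n)) set \<Rightarrow> bool" where
  "separable_lattice L \<longleftrightarrow>
    (\<exists>A1 A2. invertible A1 \<and> invertible A2 \<and> L = lattice_of (block A1 0 0 A2))"

definition symplectically_related ::
  "(real ^ ('n::finite + 'n)) set \<Rightarrow> (real ^ ('n + 'n)) set \<Rightarrow> bool" where
  "symplectically_related L L' \<longleftrightarrow> (\<exists>S\<in>Sp. L' = (*v) S ` L)"

definition int_mats :: "(real ^ 'm ^ 'm::finite) set" where
  "int_mats = {M. \<forall>i j. M $ i $ j \<in> \<int>}"

definition GL_int :: "(real ^ 'm ^ 'm::finite) set" where
  "GL_int = {M \<in> int_mats. \<exists>N\<in>int_mats. M ** N = mat 1 \<and> N ** M = mat 1}"

text \<open>\<open>Theta L\<close> is computed from a chosen generating matrix of \<open>L\<close>. Lemma \<open>Theta_lattice_of\<close> below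
  shows that every generating matrix gives the same set.\<close>

definition lattice_gen :: "(real ^ 'm::finite) set \<Rightarrow> real ^ 'm ^ 'm" where
  "lattice_gen L = (SOME A. invertible A \<and> L = lattice_of A)"

definition Theta ::
  "(real ^ ('n::finite + 'n)) set \<Rightarrow> (real ^ ('n + 'n) ^ ('n + 'n)) set" where
  "Theta L = {transpose (lattice_gen L ** M) ** Jmat ** (lattice_gen L ** M) | M. M \<in> GL_int}"

lemma int_mats_mult: "M \<in> int_mats \<Longrightarrow> N \<in> int_mats \<Longrightarrow> M ** N \<in> int_mats"
  by (auto simp: int_mats_def matrix_matrix_mult_def intro!: Ints_sum Ints_mult)

lemma GL_int_mult:
  assumes "M \<in> GL_int" "N \<in> GL_int"
  shows "M ** N \<in> GL_int"
proof -
  obtain M' where M: "M \<in> int_mats" "M' \<in> int_mats" "M ** M' = mat 1" "M' ** M = mat 1"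
    using assms(1) by (auto simp: GL_int_def)
  obtain N' where N: "N \<in> int_mats" "N' \<in> int_mats" "N ** N' = mat 1" "N' ** N = mat 1"
    using assms(2) by (auto simp: GL_int_def)
  have "(M ** N) ** (N' ** M') = M ** (N ** N') ** M'"
    by (simp add: matrix_mul_assoc)
  moreover have "(N' ** M') ** (M ** N) = N' ** (M' ** M) ** N"
    by (simp add: matrix_mul_assoc)
  ultimately have "(M ** N) ** (N' ** M') = mat 1" "(N' ** M') ** (M ** N) = mat 1"
    using M N by simp_all
  then show ?thesis
    using M N int_mats_mult unfolding GL_int_def by blast
qed

lemma lattice_of_subset_imp_int_mats:
  fixes A :: "real ^ 'm ^ 'm::finite"
  assumes "A' ** A = mat 1" "lattice_of B \<subseteq> lattice_of A"
  shows "A' ** B \<in> int_mats"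
proof -
  have "(A' ** B) $ i $ j \<in> \<int>" for i j
  proof -
    have "axis j 1 \<in> (int_vecs :: (real ^ 'm) set)"
      by (auto simp: int_vecs_def axis_def)
    then have "B *v axis j 1 \<in> lattice_of A"
      using assms(2) unfolding lattice_of_def by blast
    then obtain z where z: "z \<in> int_vecs" "B *v axis j 1 = A *v z"
      unfolding lattice_of_def by blast
    have "(A' ** B) *v axis j 1 = z"
      by (metis assms(1) matrix_vector_mul_assoc matrix_vector_mul_lid z(2))
    then have "(A' ** B) $ i $ j = z $ i"
      by (metis column_def matrix_vector_mult_basis vec_lambda_beta)
    then show ?thesis
      using z(1) by (simp add: int_vecs_def)
  qed
  then show ?thesis
    by (simp add: int_mats_def)
qed

lemma lattice_of_eq_imp_GL_int:
  fixes A B :: "real ^ 'm ^ 'm::finite"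
  assumes "invertible A" "invertible B" "lattice_of A = lattice_of B"
  obtains U where "U \<in> GL_int" "B = A ** U"
proof -
  obtain A' where A: "A ** A' = mat 1" "A' ** A = mat 1"
    using assms(1) by (auto simp: invertible_def)
  obtain B' where B: "B ** B' = mat 1" "B' ** B = mat 1"
    using assms(2) by (auto simp: invertible_def)
  have "A' ** B \<in> int_mats" "B' ** A \<in> int_mats"
    using lattice_of_subset_imp_int_mats A B assms(3) by blast+
  moreover have "(A' ** B) ** (B' ** A) = A' ** (B ** B') ** A"
    "(B' ** A) ** (A' ** B) = B' ** (A ** A') ** B"
    by (simp_all add: matrix_mul_assoc)
  ultimately have "A' ** B \<in> GL_int"
    using A B by (auto simp: GL_int_def)
  moreover have "B = A ** (A' ** B)"
    by (simp add: matrix_mul_assoc A)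
  ultimately show ?thesis
    using that by blast
qed

lemma lattice_gen:
  assumes "is_lattice L"
  shows "invertible (lattice_gen L)" "lattice_of (lattice_gen L) = L"
proof -
  have "invertible (lattice_gen L) \<and> L = lattice_of (lattice_gen L)"
    unfolding lattice_gen_def by (rule someI_ex) (use assms in \<open>simp add: is_lattice_def\<close>)
  then show "invertible (lattice_gen L)" "lattice_of (lattice_gen L) = L"
    by auto
qed

lemma Theta_lattice_of:
  fixes A :: "real ^ ('n::finite + 'n) ^ ('n + 'n)"
  assumes "invertible A"
  shows "Theta (lattice_of A) = {transpose (A ** M) ** Jmat ** (A ** M) | M. M \<in> GL_int}"
proof -
  define G where "G = lattice_gen (lattice_of A)"
  have G: "invertible G" "lattice_of G = lattice_of A"
    using lattice_gen[of "lattice_of A"] assms unfolding G_def is_lattice_def by blast+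
  obtain U where U: "U \<in> GL_int" "A = G ** U"
    using lattice_of_eq_imp_GL_int G assms by metis
  obtain V where V: "V \<in> GL_int" "G = A ** V"
    using lattice_of_eq_imp_GL_int G assms by metis
  have "\<exists>N\<in>GL_int. G ** M = A ** N" if "M \<in> GL_int" for M
    using GL_int_mult[OF V(1) that] V(2) by (metis matrix_mul_assoc)
  moreover have "\<exists>N\<in>GL_int. A ** M = G ** N" if "M \<in> GL_int" for M
    using GL_int_mult[OF U(1) that] U(2) by (metis matrix_mul_assoc)
  ultimately show ?thesis
    unfolding Theta_def G_def[symmetric] by (auto) metis+
qed

end

theory Submission
  imports Defs
begin

text \<open>For \<open>B = block B1 0 0 B2\<close> one has \<open>B\<^sup>T J B = block 0 K (- K\<^sup>T) 0\<close> with \<open>K = B1\<^sup>T B2\<close>, and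
  \<open>B\<^sup>T J B\<close> does not change when \<open>B\<close> is multiplied from the left by a symplectic matrix.
  Conversely, if \<open>A\<^sup>T J A = block 0 K (- K\<^sup>T) 0\<close>, then \<open>A\<close> and \<open>D = block 1 0 0 K\<close> induce the same
  symplectic form, so \<open>A D\<^sup>-\<^sup>1\<close> is symplectic.\<close>

lemma block_nth [simp]:
  "block P Q R T $ Inl a $ Inl b = P $ a $ b"
  "block P Q R T $ Inl a $ Inr b = Q $ a $ b"
  "block P Q R T $ Inr a $ Inl b = R $ a $ b"
  "block P Q R T $ Inr a $ Inr b = T $ a $ b"
  by (simp_all add: block_def)

lemma matrix_eq_blockI:
  fixes A B :: "'a ^ ('n::finite + 'n) ^ ('n + 'n)"
  assumes "\<And>a b. A $ Inl a $ Inl b = B $ Inl a $ Inl b"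
    and "\<And>a b. A $ Inl a $ Inr b = B $ Inl a $ Inr b"
    and "\<And>a b. A $ Inr a $ Inl b = B $ Inr a $ Inl b"
    and "\<And>a b. A $ Inr a $ Inr b = B $ Inr a $ Inr b"
  shows "A = B"
  using assms by (simp add: vec_eq_iff split_sum_all)

lemma block_mult:
  fixes P Q R T :: "real ^ 'n::finite ^ 'n"
  shows "block P Q R T ** block P' Q' R' T' =
    block (P ** P' + Q ** R') (P ** Q' + Q ** T') (R ** P' + T ** R') (R ** Q' + T ** T')"
proof -
  \<comment> \<open>The inner index of the product runs over a disjoint sum type; splitting it into
    its two halves produces the two terms of each block.\<close>
  have "(\<Sum>k\<in>UNIV. f k) = (\<Sum>a\<in>UNIV. f (Inl a)) + (\<Sum>b\<in>UNIV. f (Inr b))"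
    for f :: "'n + 'n \<Rightarrow> real"
    by (simp add: UNIV_Plus_UNIV[symmetric] sum.Plus del: UNIV_Plus_UNIV)
  then show ?thesis
    by (intro matrix_eq_blockI) (simp_all add: matrix_matrix_mult_def)
qed

lemma transpose_block:
  "transpose (block P Q R T) = block (transpose P) (transpose R) (transpose Q) (transpose T)"
  by (intro matrix_eq_blockI) (simp_all add: transpose_def)

lemma block_one: "block (mat 1) 0 0 (mat 1) = mat 1"
  by (intro matrix_eq_blockI) (simp_all add: mat_def)

lemma block_uminus: "block (- P) (- Q) (- R) (- T) = - block P Q R T"
  by (intro matrix_eq_blockI) simp_all

lemma matrix_mult_uminus_left: "(- A :: real ^ 'm ^ 'k) ** B = - (A ** B)"
  by (simp add: vec_eq_iff matrix_matrix_mult_def sum_negf)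

lemma matrix_mult_uminus_right: "(A :: real ^ 'm ^ 'k) ** (- B) = - (A ** B)"
  by (simp add: vec_eq_iff matrix_matrix_mult_def sum_negf)

lemma invertible_block_diag:
  assumes "invertible P" "invertible T"
  shows "invertible (block P 0 0 T)"
proof -
  obtain P' T' where "P ** P' = mat 1" "P' ** P = mat 1" "T ** T' = mat 1" "T' ** T = mat 1"
    using assms by (auto simp: invertible_def)
  then have "block P 0 0 T ** block P' 0 0 T' = mat 1" "block P' 0 0 T' ** block P 0 0 T = mat 1"
    by (simp_all add: block_mult block_one)
  then show ?thesis
    unfolding invertible_def by blast
qed

lemma Jmat_square: "Jmat ** Jmat = - mat 1"
  \<comment> \<open>The blocks multiply to \<open>block (- mat 1) 0 0 (- mat 1)\<close>; this
    instance recognises it as \<open>- mat 1\<close>.\<close>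
  using block_uminus[of "mat 1" 0 0 "mat 1"]
  by (simp add: Jmat_def block_mult matrix_mult_uminus_left matrix_mult_uminus_right block_one)

text \<open>The lower left block arises as \<open>- (transpose T ** P)\<close>, which is minus the
  transpose of the upper right one. Taking \<open>P = mat 1\<close> and \<open>T = K\<close>
  realises any prescribed \<open>K\<close>.\<close>

lemma form_block_diag:
  fixes P T :: "real ^ 'n::finite ^ 'n"
  shows "transpose (block P 0 0 T) ** Jmat ** block P 0 0 T =
    block 0 (transpose P ** T) (- transpose (transpose P ** T)) 0"
proof -
  have "transpose (0 :: real ^ 'n ^ 'n) = 0"
    by (simp add: transpose_def vec_eq_iff)
  then show ?thesis
    by (simp add: Jmat_def transpose_block block_mult matrix_mult_uminus_left
        matrix_mult_uminus_right matrix_transpose_mul)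
qed

text \<open>A change of basis acts on Gram matrices by congruence. Read with \<open>A\<close>
  symplectic it gives invariance of the form; read with \<open>M\<close> an inverse it allows
  cancellation.\<close>

lemma form_mult:
  fixes A :: "real ^ 'm::finite ^ 'p::finite" and M :: "real ^ 'k ^ 'm"
  shows "transpose (A ** M) ** J ** (A ** M) = transpose M ** (transpose A ** J ** A) ** M"
  by (simp add: matrix_transpose_mul matrix_mul_assoc)

lemma form_Sp_mult:
  assumes "S \<in> Sp"
  shows "transpose (S ** A) ** Jmat ** (S ** A) = transpose A ** Jmat ** A"
  using assms by (simp add: form_mult Sp_def)

text \<open>Congruence by \<open>D'\<close> keeps the two Gram matrices equal, and on the side of
  \<open>D\<close> it leaves \<open>Jmat\<close>.\<close>

lemma same_form_imp_Sp:
  assumes D: "D ** D' = mat 1"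
    and eq: "transpose A ** Jmat ** A = transpose D ** Jmat ** D"
  shows "A ** D' \<in> Sp"
proof -
  have "transpose (A ** D') ** Jmat ** (A ** D') = transpose (D ** D') ** Jmat ** (D ** D')"
    by (simp only: form_mult eq)
  then show ?thesis
    by (simp add: Sp_def D transpose_mat)
qed

lemma Sp_inverse:
  assumes "S \<in> Sp"
  obtains T where "T \<in> Sp" "S ** T = mat 1" "T ** S = mat 1"
proof -
  \<comment> \<open>Multiplying \<open>transpose S ** Jmat ** S = Jmat\<close> by
    \<open>- Jmat\<close> from the left gives \<open>mat 1\<close>, since \<open>Jmat\<close>
    squares to \<open>- mat 1\<close>; so this is the inverse of \<open>S\<close>.\<close>
  define T where "T = - (Jmat ** transpose S ** Jmat)"
  have "T ** S = - (Jmat ** (transpose S ** Jmat ** S))"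
    by (simp add: T_def matrix_mult_uminus_left matrix_mul_assoc)
  also have "\<dots> = mat 1"
    using assms by (simp add: Sp_def Jmat_square)
  finally have 1: "T ** S = mat 1" .
  then have 2: "S ** T = mat 1"
    using matrix_left_right_inverse by blast
  \<comment> \<open>Both \<open>mat 1\<close> and \<open>S\<close> have Gram matrix
    \<open>Jmat\<close>, so \<open>same_form_imp_Sp\<close> applies with
    \<open>D = S\<close>.\<close>
  have "mat 1 ** T \<in> Sp"
    using same_form_imp_Sp[OF 2, of "mat 1"] assms by (simp add: Sp_def transpose_mat)
  then show ?thesis
    using that 1 2 by simp
qed

lemma lattice_of_mult: "lattice_of (A ** B) = (*v) A ` lattice_of B"
  by (simp add: lattice_of_def image_image matrix_vector_mul_assoc)

text \<open>\<open>M\<close> maps the integer vectors onto themselves: its integer entries keep the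
  image integral, and its integer inverse \<open>N\<close> supplies the preimage
  \<open>N *v v\<close>.\<close>

lemma lattice_of_GL_int_mult:
  fixes A :: "real ^ 'm ^ 'm::finite"
  assumes "M \<in> GL_int"
  shows "lattice_of (A ** M) = lattice_of A"
proof -
  obtain N where M: "M \<in> int_mats" "N \<in> int_mats" "M ** N = mat 1"
    using assms by (auto simp: GL_int_def)
  have int: "X *v v \<in> int_vecs" if "X \<in> int_mats" "v \<in> int_vecs"
    for X :: "real ^ 'm ^ 'm" and v
    using that by (auto simp: int_mats_def int_vecs_def matrix_vector_mult_def
        intro!: Ints_sum Ints_mult)
  have "v \<in> (*v) M ` int_vecs" if "v \<in> int_vecs" for v
    using int[OF M(2) that] M(3)
    by (intro image_eqI[of _ _ "N *v v"]) (simp_all add: matrix_vector_mul_assoc)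
  then have "lattice_of M = int_vecs"
    unfolding lattice_of_def using int[OF M(1)] by blast
  then show ?thesis
    by (simp add: lattice_of_mult) (simp add: lattice_of_def)
qed

lemma GL_int_imp_invertible: "M \<in> GL_int \<Longrightarrow> invertible M"
  by (auto simp: GL_int_def invertible_def)

text \<open>The generating matrices of \<open>L\<close> are exactly the products
  \<open>G ** M\<close> with \<open>M\<close> in \<open>GL_int\<close>. This removes the chosen
  generator and turns membership in \<open>Theta L\<close> into a statement about some basis of
  \<open>L\<close>.\<close>

lemma Theta_eq_forms:
  assumes "is_lattice L"
  shows "Theta L = {transpose A ** Jmat ** A | A. invertible A \<and> L = lattice_of A}"
proof -
  obtain G where G: "invertible G" "L = lattice_of G"
    using assms by (auto simp: is_lattice_def)
  have "\<exists>M\<in>GL_int. A = G ** M" if "invertible A" "L = lattice_of A" for A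
    using lattice_of_eq_imp_GL_int[OF G(1) that(1)] G(2) that(2) by metis
  moreover have "invertible (G ** M) \<and> L = lattice_of (G ** M)" if "M \<in> GL_int" for M
    using that G by (simp add: invertible_mult GL_int_imp_invertible lattice_of_GL_int_mult)
  ultimately show ?thesis
    unfolding G(2) Theta_lattice_of[OF G(1)] by (auto simp: G(2)[symmetric]) metis+
qed

text \<open>The relation moves \<open>L\<close> to a separable lattice, whereas the factorisation
  moves a separable lattice to \<open>L\<close>; symplectic inverses pass from one to the
  other.\<close>

lemma symplectically_related_separable_iff:
  "(\<exists>L'. separable_lattice L' \<and> symplectically_related L L') \<longleftrightarrow>
    (\<exists>B1 B2 S. invertible B1 \<and> invertible B2 \<and> S \<in> Sp \<and> L = lattice_of (S ** block B1 0 0 B2))"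
  (is "?lhs \<longleftrightarrow> ?rhs")
proof
  assume ?lhs
  then obtain B1 B2 S where B: "invertible B1" "invertible B2" "S \<in> Sp"
    "lattice_of (block B1 0 0 B2) = (*v) S ` L"
    by (auto simp: separable_lattice_def symplectically_related_def)
  obtain T where T: "T \<in> Sp" "T ** S = mat 1"
    using Sp_inverse[OF B(3)] .
  have "lattice_of (T ** block B1 0 0 B2) = L"
    using T(2) by (simp add: lattice_of_mult B(4) image_image matrix_vector_mul_assoc)
  then show ?rhs
    using B T by blast
next
  assume ?rhs
  then obtain B1 B2 S where B: "invertible B1" "invertible B2" "S \<in> Sp"
    "L = lattice_of (S ** block B1 0 0 B2)"
    by blast
  obtain T where T: "T \<in> Sp" "T ** S = mat 1"
    using Sp_inverse[OF B(3)] .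
  have "lattice_of (block B1 0 0 B2) = (*v) T ` L"
    using T(2) by (simp add: lattice_of_mult B(4) image_image matrix_vector_mul_assoc)
  then show ?lhs
    using B T unfolding separable_lattice_def symplectically_related_def by blast
qed

lemma off_diagonal_form_iff:
  "(\<exists>A. invertible A \<and> L = lattice_of A \<and>
      (\<exists>K. invertible K \<and> transpose A ** Jmat ** A = block 0 K (- transpose K) 0)) \<longleftrightarrow>
    (\<exists>B1 B2 S. invertible B1 \<and> invertible B2 \<and> S \<in> Sp \<and> L = lattice_of (S ** block B1 0 0 B2))"
  (is "?lhs \<longleftrightarrow> ?rhs")
proof
  assume ?lhs
  then obtain A K where A: "L = lattice_of A" "invertible K"
    "transpose A ** Jmat ** A = block 0 K (- transpose K) 0"
    by blast
  define D where "D = block (mat 1) 0 0 K"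
  have one: "invertible (mat 1 :: real ^ 'a ^ 'a)"
    unfolding invertible_def by (intro exI[of _ "mat 1"]) simp
  have "invertible D"
    unfolding D_def using one A(2) by (rule invertible_block_diag)
  then obtain D' where D': "D ** D' = mat 1" "D' ** D = mat 1"
    by (auto simp: invertible_def)
  have "transpose A ** Jmat ** A = transpose D ** Jmat ** D"
    by (simp add: A(3) D_def form_block_diag transpose_mat)
  then have "A ** D' \<in> Sp"
    using D'(1) same_form_imp_Sp by blast
  \<comment> \<open>This is the required factorisation, with \<open>S = A ** D'\<close>,
    \<open>B1 = mat 1\<close> and \<open>B2 = K\<close>.\<close>
  moreover have "A = (A ** D') ** D"
    using D'(2) by (simp flip: matrix_mul_assoc)
  ultimately show ?rhs
    using A(1,2) one unfolding D_def by metis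
next
  assume ?rhs
  then obtain B1 B2 S where B: "invertible B1" "invertible B2" "S \<in> Sp"
    "L = lattice_of (S ** block B1 0 0 B2)"
    by blast
  have "invertible S"
    using Sp_inverse[OF B(3)] unfolding invertible_def by metis
  then have "invertible (S ** block B1 0 0 B2)"
    using B invertible_block_diag invertible_mult by blast
  \<comment> \<open>This product is the witness for \<open>K\<close>.\<close>
  moreover have "invertible (transpose B1 ** B2)"
    using B by (simp add: invertible_mult transpose_invertible)
  ultimately show ?lhs
    using B form_Sp_mult form_block_diag by metis
qed

theorem proposition3p9:
  fixes \<Lambda> :: "(real ^ ('n::finite + 'n)) set"
  assumes "is_lattice \<Lambda>"
  shows "((\<exists>\<Lambda>'. separable_lattice \<Lambda>' \<and> symplectically_related \<Lambda> \<Lambda>')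
            \<longleftrightarrow> (\<exists>K :: real ^ 'n ^ 'n. invertible K \<and> block 0 K (- transpose K) 0 \<in> Theta \<Lambda>))
       \<and> ((\<exists>A :: real ^ ('n + 'n) ^ ('n + 'n). invertible A \<and> \<Lambda> = lattice_of A \<and>
              (\<exists>K :: real ^ 'n ^ 'n. invertible K \<and>
                 transpose A ** Jmat ** A = block 0 K (- transpose K) 0))
            \<longleftrightarrow> (\<exists>(B :: real ^ ('n + 'n) ^ ('n + 'n)) (B1 :: real ^ 'n ^ 'n) (B2 :: real ^ 'n ^ 'n) S.
                  invertible B \<and> B = block B1 0 0 B2 \<and> invertible B1 \<and> invertible B2 \<and>
                  S \<in> Sp \<and> \<Lambda> = lattice_of (S ** B)))"
proof -
  \<comment> \<open>By \<open>Theta_eq_forms\<close> the condition on \<open>Theta\<close> is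
    condition (a) itself, so all four conditions reduce to the one factorisation shared by the two
    preceding equivalences.\<close>
  have "(\<exists>K :: real ^ 'n ^ 'n. invertible K \<and> block 0 K (- transpose K) 0 \<in> Theta \<Lambda>) \<longleftrightarrow>
    (\<exists>A. invertible A \<and> \<Lambda> = lattice_of A \<and>
      (\<exists>K. invertible K \<and> transpose A ** Jmat ** A = block 0 K (- transpose K) 0))"
    unfolding Theta_eq_forms[OF assms] mem_Collect_eq by metis
  moreover have "(\<exists>(B :: real ^ ('n + 'n) ^ ('n + 'n)) B1 B2 S.
      invertible B \<and> B = block B1 0 0 B2 \<and> invertible B1 \<and> invertible B2 \<and>
      S \<in> Sp \<and> \<Lambda> = lattice_of (S ** B)) \<longleftrightarrow>
    (\<exists>B1 B2 S. invertible B1 \<and> invertible B2 \<and> S \<in> Sp \<and> \<Lambda> = lattice_of (S ** block B1 0 0 B2))"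
    using invertible_block_diag by blast
  ultimately show ?thesis
    by (simp only: off_diagonal_form_iff symplectically_related_separable_iff)
qed

end
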